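(* A virtually solvable group cannot be highly transitive; that is, a virtually solvable group admits no effective action on an infinite set $X$ which is $m$-transitive for every $m\in\mathbb{N}$.
   Context: A group is highly transitive if it admits an effective action on an infinite set $X$ that is $m$-transitive for every $m\in\mathbb{N}$, i.e. transitive on ordered $m$-tuples of pairwise distinct elements of $X$. A group is virtually solvable if it contains a solvable subgroup of finite index. *)

theory Defs
  imports "HOL-Algebra.Group_Action" "HOL-Algebra.Solvable_Groups"
begin

definition virtually_solvable :: "('a, 'b) monoid_scheme \<Rightarrow> bool" where
  "virtually_solvable G \<longleftrightarrow>
     (\<exists>H. subgroup H G \<and> finite (rcosets\<^bsub>G\<^esub> H) \<and> solvable (G\<lparr>carrier := H\<rparr>))"

text \<open>Ordered \<open>m\<close>-tuples of pairwise distinct elements of \<open>X\<close> are distinct lists of length \<open>m\<close>.\<close>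

definition m_transitive ::
    "('a, 'b) monoid_scheme \<Rightarrow> 'x set \<Rightarrow> ('a \<Rightarrow> 'x \<Rightarrow> 'x) \<Rightarrow> nat \<Rightarrow> bool" where
  "m_transitive G X \<phi> m \<longleftrightarrow>
     (\<forall>xs ys. length xs = m \<and> distinct xs \<and> set xs \<subseteq> X \<and>
              length ys = m \<and> distinct ys \<and> set ys \<subseteq> X
       \<longrightarrow> (\<exists>g\<in>carrier G. map (\<phi> g) xs = ys))"

text \<open>HOL cannot quantify over types inside a formula, so the type \<open>'x\<close> in which the set \<open>X\<close> lives
  is a parameter. A theorem refuting \<open>highly_transitive TYPE('x) G\<close> with \<open>'x\<close> a type variable
  excludes actions on infinite sets of every type.\<close>

definition highly_transitive :: "'x itself \<Rightarrow> ('a, 'b) monoid_scheme \<Rightarrow> bool" where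
  "highly_transitive _ G \<longleftrightarrow>
     (\<exists>(X :: 'x set) \<phi>. infinite X \<and> faithful_action G X \<phi> \<and> (\<forall>m. m_transitive G X \<phi> m))"

end

theory Submission
  imports Defs
begin

text \<open>High transitivity passes to finite-index subgroups and to derived subgroups, and the trivial
  group does not have it. Since \<open>X\<close> is infinite, it suffices to move a tuple to a disjoint one. For
  a subgroup of index \<open>k\<close>, pick \<open>g\<close> which moves \<open>xs\<close> to \<open>ys\<close> in \<open>k!\<close> steps through fresh tuples;
  then \<open>g ^ k!\<close> lies in the subgroup. For the derived subgroup, the commutator \<open>[g, h]\<close> moves \<open>xs\<close>
  to \<open>ys\<close> when \<open>g\<close> moves \<open>zs, ws\<close> to \<open>xs, ys\<close> and \<open>h\<close> fixes \<open>xs\<close> and moves \<open>zs\<close> to \<open>ws\<close>,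
  for fresh tuples \<open>zs, ws\<close>.\<close>

lemma m_transitiveD:
  assumes "m_transitive G X \<phi> (length xs)" "length ys = length xs"
    and "distinct xs" "set xs \<subseteq> X" "distinct ys" "set ys \<subseteq> X"
  shows "\<exists>g\<in>carrier G. map (\<phi> g) xs = ys"
  using assms unfolding m_transitive_def by blast

lemma obtain_fresh_list:
  assumes "infinite X" "finite F"
  obtains zs where "length zs = m" "distinct zs" "set zs \<subseteq> X" "set zs \<inter> F = {}"
proof -
  obtain Z where "finite Z" "card Z = m" "Z \<subseteq> X - F"
    using infinite_arbitrarily_large[of "X - F" m] assms by auto
  moreover obtain zs where "set zs = Z" "distinct zs"
    using finite_distinct_list[OF \<open>finite Z\<close>] by blast
  ultimately show thesis
    using that[of zs] distinct_card[of zs] by auto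
qed

context group_action
begin

lemma map_mult:
  assumes "g \<in> carrier G" "h \<in> carrier G" "set xs \<subseteq> E"
  shows "map (\<phi> (g \<otimes> h)) xs = map (\<phi> g) (map (\<phi> h) xs)"
  using assms composition_rule by auto

lemma map_inv:
  assumes "g \<in> carrier G" "set xs \<subseteq> E" "map (\<phi> g) xs = ys"
  shows "map (\<phi> (inv g)) ys = xs"
  using assms orbit_sym_aux[OF _ _ refl] by (auto intro!: map_idI simp: subset_iff)

lemma group_action_restrict:
  assumes "subgroup H G"
  shows "group_action (G\<lparr>carrier := H\<rparr>) E \<phi>"
proof -
  interpret group_hom G "BijGroup E" \<phi>
    by (rule group_hom)
  have "group (G\<lparr>carrier := H\<rparr>)"
    using assms by (rule G.subgroup_imp_group)
  moreover have "\<phi> \<in> hom (G\<lparr>carrier := H\<rparr>) (BijGroup E)"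
    using hom_mult hom_closed subgroup.mem_carrier[OF assms] by (auto intro!: homI)
  ultimately show ?thesis
    using H.is_group by (simp add: group_action_def group_hom_def group_hom_axioms_def)
qed

text \<open>If \<open>xs\<close> and \<open>ys\<close> overlap, go through a tuple \<open>zs\<close>
  that is fresh for both: \<open>K\<close> is closed under products, so an element moving
  \<open>xs\<close> to \<open>zs\<close> composes with one moving \<open>zs\<close> to
  \<open>ys\<close>.\<close>

lemma m_transitive_of_disjoint:
  assumes "infinite E" "subgroup K G"
    and disj: "\<And>xs ys. \<lbrakk>length xs = m; length ys = m; distinct xs; distinct ys;
      set xs \<subseteq> E; set ys \<subseteq> E; set xs \<inter> set ys = {}\<rbrakk> \<Longrightarrow> \<exists>g\<in>K. map (\<phi> g) xs = ys"
  shows "m_transitive (G\<lparr>carrier := K\<rparr>) E \<phi> m"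
  unfolding m_transitive_def
proof (intro allI impI, elim conjE)
  fix xs ys
  assume xy: "length xs = m" "distinct xs" "set xs \<subseteq> E" "length ys = m" "distinct ys" "set ys \<subseteq> E"
  obtain zs where zs: "length zs = m" "distinct zs" "set zs \<subseteq> E" "set zs \<inter> (set xs \<union> set ys) = {}"
    using obtain_fresh_list[OF \<open>infinite E\<close>, of "set xs \<union> set ys" m] by auto
  have "\<exists>h\<in>K. map (\<phi> h) xs = zs"
    by (rule disj) (use xy zs in auto)
  then obtain h where h: "h \<in> K" "map (\<phi> h) xs = zs"
    by blast
  have "\<exists>g\<in>K. map (\<phi> g) zs = ys"
    by (rule disj) (use xy zs in auto)
  then obtain g where g: "g \<in> K" "map (\<phi> g) zs = ys"
    by blast
  have "map (\<phi> (g \<otimes> h)) xs = ys"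
    using map_mult[of g h xs] g h xy subgroup.mem_carrier[OF \<open>subgroup K G\<close>] by simp
  then show "\<exists>g\<in>carrier (G\<lparr>carrier := K\<rparr>). map (\<phi> g) xs = ys"
    using subgroup.m_closed[OF \<open>subgroup K G\<close> g(1) h(1)] by auto
qed

lemma m_transitive_derived:
  assumes inf: "infinite E" and K: "subgroup K G"
    and trans: "\<And>m. m_transitive (G\<lparr>carrier := K\<rparr>) E \<phi> m"
  shows "m_transitive (G\<lparr>carrier := derived G K\<rparr>) E \<phi> m"
proof -
  interpret G: group G
    using group_hom by (rule group_hom.axioms(1))
  have KG: "K \<subseteq> carrier G"
    using subgroup.subset[OF K] .
  show ?thesis
  proof (rule m_transitive_of_disjoint[OF inf G.derived_is_subgroup[OF KG]])
    fix xs ys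
    assume xy: "length xs = m" "length ys = m" "distinct xs" "distinct ys"
      "set xs \<subseteq> E" "set ys \<subseteq> E" "set xs \<inter> set ys = {}"
    obtain zs where zs: "length zs = m" "distinct zs" "set zs \<subseteq> E"
      "set zs \<inter> (set xs \<union> set ys) = {}"
      using obtain_fresh_list[OF inf, of "set xs \<union> set ys" m] by auto
    obtain ws where ws: "length ws = m" "distinct ws" "set ws \<subseteq> E"
      "set ws \<inter> (set xs \<union> set ys \<union> set zs) = {}"
      using obtain_fresh_list[OF inf, of "set xs \<union> set ys \<union> set zs" m] by auto
    \<comment> \<open>This is transitivity of \<open>K\<close> on tuples of length
      \<open>2 * m\<close>. The reduction to disjoint \<open>xs\<close> and \<open>ys\<close> makes
      \<open>xs @ ys\<close> distinct.\<close>
    have "\<exists>g\<in>carrier (G\<lparr>carrier := K\<rparr>). map (\<phi> g) (zs @ ws) = xs @ ys"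
      by (rule m_transitiveD[OF trans]) (use xy zs ws in auto)
    then obtain g where g: "g \<in> K" "map (\<phi> g) (zs @ ws) = xs @ ys"
      by auto
    have "\<exists>h\<in>carrier (G\<lparr>carrier := K\<rparr>). map (\<phi> h) (xs @ zs) = xs @ ws"
      by (rule m_transitiveD[OF trans]) (use xy zs ws in auto)
    then obtain h where h: "h \<in> K" "map (\<phi> h) (xs @ zs) = xs @ ws"
      by auto
    have carr: "g \<in> carrier G" "h \<in> carrier G"
      using g h KG by auto
    have maps: "map (\<phi> g) zs = xs" "map (\<phi> g) ws = ys" "map (\<phi> h) xs = xs" "map (\<phi> h) zs = ws"
      using g(2) h(2) xy zs ws by simp_all
    \<comment> \<open>Read from right to left: \<open>inv h\<close> fixes \<open>xs\<close>,
      \<open>inv g\<close> takes it to \<open>zs\<close>, \<open>h\<close> takes that to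
      \<open>ws\<close>, and \<open>g\<close> takes \<open>ws\<close> to \<open>ys\<close>.\<close>
    have "map (\<phi> (g \<otimes> h \<otimes> inv g \<otimes> inv h)) xs = ys"
      using carr maps map_inv[of g zs xs] map_inv[of h xs xs] xy zs ws
      by (simp add: map_mult del: map_map)
    moreover have "g \<otimes> h \<otimes> inv g \<otimes> inv h \<in> derived G K"
      unfolding derived_def using g(1) h(1) by (intro generate.incl) auto
    ultimately show "\<exists>g\<in>derived G K. map (\<phi> g) xs = ys"
      by blast
  qed
qed

lemma m_transitive_funpow_derived:
  assumes "infinite E" "subgroup K G" "\<And>m. m_transitive (G\<lparr>carrier := K\<rparr>) E \<phi> m"
  shows "m_transitive (G\<lparr>carrier := (derived G ^^ n) K\<rparr>) E \<phi> m"
\<comment> \<open>\<open>m\<close> must vary, since each derived subgroup inherits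
  \<open>m\<close>-transitivity from \<open>2 * m\<close>-transitivity of the previous one.\<close>
proof (induction n arbitrary: m)
  case (Suc n)
  interpret G: group G
    using group_hom by (rule group_hom.axioms(1))
  show ?case
    using m_transitive_derived[OF assms(1) G.exp_of_derived_is_subgroup[OF assms(2)] Suc] by simp
qed (use assms in simp)

end

text \<open>Among the \<open>k + 1\<close> cosets of the powers of \<open>g\<close> with exponents 0
  to \<open>k\<close>, two coincide, so some power with exponent between 1 and \<open>k\<close> lies
  in \<open>H\<close>, and this exponent divides \<open>fact k\<close>. The index \<open>k\<close>
  alone would not do as exponent, because \<open>H\<close> need not be normal.\<close>

lemma (in group) pow_fact_mem_subgroup:
  assumes H: "subgroup H G" and fin: "finite (rcosets H)" and g: "g \<in> carrier G"
  shows "g [^] (fact (card (rcosets H)) :: nat) \<in> H"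
proof -
  define k where "k = card (rcosets H)"
  have "(\<lambda>i. H #> g [^] i) ` {..k} \<subseteq> rcosets H"
    using g rcosetsI[OF subgroup.subset[OF H]] by auto
  then have "card ((\<lambda>i. H #> g [^] i) ` {..k}) < card {..k}"
    using card_mono[OF fin] by (simp add: k_def le_imp_less_Suc)
  then have "\<not> inj_on (\<lambda>i. H #> g [^] i) {..k}"
    by (rule pigeonhole)
  then obtain i j :: nat where ij: "i < j" "j \<le> k" "H #> g [^] i = H #> g [^] j"
    unfolding inj_on_def by (metis atMost_iff linorder_neqE_nat)
  have "g [^] j \<in> H #> g [^] i"
    using ij(3) rcos_self[OF _ H] g by simp
  then obtain h where h: "h \<in> H" "g [^] j = h \<otimes> g [^] i"
    by (auto simp: r_coset_def)
  have "g [^] (j - i) \<otimes> g [^] i = h \<otimes> g [^] i"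
    using h(2) ij(1) g by (simp add: nat_pow_mult)
  then have n: "g [^] (j - i) \<in> H"
    using h(1) g subgroup.mem_carrier[OF H] by (metis nat_pow_closed right_cancel)
  have "(j - i) dvd fact k"
    using ij by (intro dvd_fact) auto
  then obtain q :: nat where "fact k = (j - i) * q"
    by (rule dvdE)
  then have "g [^] (fact k :: nat) = (g [^] (j - i)) [^] q"
    using g by (simp add: nat_pow_pow)
  moreover have "(g [^] (j - i)) [^] q \<in> H"
    using n subgroup.m_closed[OF H] subgroup.one_closed[OF H] by (induction q) auto
  ultimately show ?thesis
    by (simp add: k_def)
qed

lemma (in group_action) m_transitive_finite_index:
  assumes inf: "infinite E" and H: "subgroup H G" and fin: "finite (rcosets H)"
    and trans: "\<And>m. m_transitive G E \<phi> m"
  shows "m_transitive (G\<lparr>carrier := H\<rparr>) E \<phi> m"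
proof (rule m_transitive_of_disjoint[OF inf H])
  interpret G: group G
    using group_hom by (rule group_hom.axioms(1))
  fix xs ys
  assume xy: "length xs = m" "length ys = m" "distinct xs" "distinct ys"
    "set xs \<subseteq> E" "set ys \<subseteq> E" "set xs \<inter> set ys = {}"
  define N :: nat where "N = fact (card (rcosets H))"
  obtain M where M: "N = Suc M"
    unfolding N_def using fact_gt_zero[of "card (rcosets H)"] gr0_conv_Suc by blast
  obtain zs where zs: "length zs = m * M" "distinct zs" "set zs \<subseteq> E"
    "set zs \<inter> (set xs \<union> set ys) = {}"
    using obtain_fresh_list[OF inf, of "set xs \<union> set ys" "m * M"] by auto
  \<comment> \<open>\<open>L\<close> consists of \<open>N + 1\<close> blocks of length
    \<open>m\<close>: first \<open>xs\<close>, then the \<open>M = N - 1\<close> blocks of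
    \<open>zs\<close>, last \<open>ys\<close>. The positive factorial ensures that \<open>M\<close>
    exists.\<close>
  define L where "L = xs @ zs @ ys"
  have L: "length L = m + m * N" "distinct L" "set L \<subseteq> E"
    using xy zs M by (auto simp: L_def)
  \<comment> \<open>One application of \<open>m * N\<close>-transitivity yields a \<open>g\<close>
    that shifts every block of \<open>L\<close> but the last to the next one, so its
    \<open>N\<close>-th power carries \<open>xs\<close> to \<open>ys\<close>.\<close>
  have "\<exists>g\<in>carrier G. map (\<phi> g) (xs @ zs) = zs @ ys"
    by (rule m_transitiveD[OF trans]) (use xy zs in auto)
  then obtain g where g: "g \<in> carrier G" "map (\<phi> g) (xs @ zs) = zs @ ys"
    by blast
  have "take (m * N) L = xs @ zs" "drop m L = zs @ ys"
    using xy zs M by (simp_all add: L_def)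
  then have shift: "map (\<phi> g) (take (m * N) L) = drop m L"
    using g(2) by simp
  have step: "\<phi> g (L ! i) = L ! (i + m)" if "i < m * N" for i
    using arg_cong[OF shift, of "\<lambda>l. l ! i"] that L(1) by (simp add: add.commute)
  \<comment> \<open>The index \<open>i\<close> varies in the induction: the rightmost factor
    \<open>g\<close> acts first and moves index \<open>i\<close> to \<open>i + m\<close>, where the
    induction hypothesis applies.\<close>
  have pow: "\<phi> (g [^] n) (L ! i) = L ! (i + m * n)" if "i + m * n < length L" for i n
    using that
  proof (induction n arbitrary: i)
    case 0
    then show ?case
      \<comment> \<open>The unit acts as the identity restricted to \<open>E\<close>, so the entry
        of \<open>L\<close> must be known to lie in \<open>E\<close>.\<close>
      using id_eq_one L(3) by (metis G.nat_pow_0 add.right_neutral mult_0_right nth_mem restrict_apply'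
          subsetD)
  next
    case (Suc n)
    have "L ! i \<in> E"
      using Suc.prems L(3) by (auto intro: nth_mem)
    then have "\<phi> (g [^] Suc n) (L ! i) = \<phi> (g [^] n) (\<phi> g (L ! i))"
      using g(1) by (simp add: composition_rule)
    also have "\<phi> g (L ! i) = L ! (i + m)"
      by (rule step) (use Suc.prems L(1) in \<open>simp add: algebra_simps\<close>)
    finally show ?case
      using Suc.IH[of "i + m"] Suc.prems by (simp add: algebra_simps)
  qed
  have "map (\<phi> (g [^] N)) xs = ys"
  proof (rule nth_equalityI)
    fix i assume "i < length (map (\<phi> (g [^] N)) xs)"
    then have "i < m"
      using xy by simp
    then have "L ! i = xs ! i" "L ! (i + m * N) = ys ! i"
      using xy zs M by (simp_all add: L_def nth_append)
    then show "map (\<phi> (g [^] N)) xs ! i = ys ! i"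
      using pow[of i N] \<open>i < m\<close> xy L(1) by simp
  qed (use xy in simp)
  then show "\<exists>g\<in>H. map (\<phi> g) xs = ys"
    using G.pow_fact_mem_subgroup[OF H fin g(1)] by (auto simp: N_def)
qed

theorem corollary5p8:
  fixes G :: "('a, 'b) monoid_scheme"
  assumes "group G" and "virtually_solvable G"
  shows "\<not> highly_transitive TYPE('x) G"
proof
  assume "highly_transitive TYPE('x) G"
  then obtain X :: "'x set" and \<phi> where inf: "infinite X" and "faithful_action G X \<phi>"
    and trans: "\<And>m. m_transitive G X \<phi> m"
    unfolding highly_transitive_def by blast
  then interpret group_action G X \<phi>
    by (simp add: faithful_action_def)
  obtain H where H: "subgroup H G" "finite (rcosets\<^bsub>G\<^esub> H)" "solvable (G\<lparr>carrier := H\<rparr>)"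
    using assms(2) unfolding virtually_solvable_def by blast
  let ?H = "G\<lparr>carrier := H\<rparr>"
  \<comment> \<open>The derived series is formed inside \<open>?H\<close>, so the lemma on its terms
    is applied to the action of \<open>?H\<close>.\<close>
  interpret H: group_action ?H X \<phi>
    using H(1) by (rule group_action_restrict)
  interpret H: group ?H
    using H(1) assms(1) by (simp add: group.subgroup_imp_group)
  obtain n where n: "(derived ?H ^^ n) H = {\<one>\<^bsub>?H\<^esub>}"
    using H.solvable_imp_trivial_derived_seq[of H] H(3) by (auto simp: solvable_def)
  \<comment> \<open>Tuples of length 1 suffice for the contradiction: the trivial group would be
    transitive on a set with two distinct points.\<close>
  have "m_transitive (?H\<lparr>carrier := (derived ?H ^^ n) H\<rparr>) X \<phi> 1"
  proof (rule H.m_transitive_funpow_derived[OF inf])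
    show "subgroup H ?H"
      using H.subgroup_self by simp
    show "m_transitive (?H\<lparr>carrier := H\<rparr>) X \<phi> m" for m
      using m_transitive_finite_index[OF inf H(1,2) trans] by simp
  qed
  then have one: "m_transitive (?H\<lparr>carrier := {\<one>\<^bsub>?H\<^esub>}\<rparr>) X \<phi> (length [x])" for x
    using n by simp
  obtain zs where zs: "length zs = 2" "distinct zs" "set zs \<subseteq> X"
    using obtain_fresh_list[OF inf finite.emptyI] by metis
  then obtain x y where xy: "x \<in> X" "y \<in> X" "x \<noteq> y"
    by (auto simp: numeral_2_eq_2 length_Suc_conv)
  obtain g where "g \<in> {\<one>\<^bsub>?H\<^esub>}" "map (\<phi> g) [x] = [y]"
    using m_transitiveD[OF one, of "[y]" x] xy by auto
  then show False
    using H.id_eq_one xy by (metis list.inject list.map(2) restrict_apply' singletonD)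
qed

end
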